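(* For every $n\ge2$ and $\kappa\ge1$, $$p_{n,n-1}(\kappa)=\frac{n}{(n-1)\kappa+1}.$$
   Context: For integers $1\le r\le n-1$ and $\kappa\ge1$ let $$P_{n,r,\kappa}(z):=(1-z)^r\Bigl(1+\frac{\kappa r}{n-r}z\Bigr)^{n-r},\qquad 0\le z\le1.$$ If $\kappa>1$, $p_{n,r}(\kappa)\in(0,1)$ denotes the unique solution $p\in(0,1)$ of $\int_0^1z^{-p}P'_{n,r,\kappa}(z)\,dz=0$. For $\kappa=1$, $p_{n,r}(1):=1$. *)

theory Defs
  imports "HOL-Analysis.Analysis"
begin

text \<open>All parameters are meant in the range \<open>1 \<le> r \<le> n - 1\<close>, \<open>\<kappa> \<ge> 1\<close>; in particular the
  truncated exponent \<open>n - r\<close> is the true difference there.\<close>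

definition P :: "nat \<Rightarrow> nat \<Rightarrow> real \<Rightarrow> real \<Rightarrow> real" where
  "P n r \<kappa> z = (1 - z) ^ r * (1 + \<kappa> * real r / (real n - real r) * z) ^ (n - r)"

text \<open>The integrand is singular at \<open>0\<close>, where \<open>powr\<close> returns the conventional value \<open>0\<close>; this single
  point does not affect the integral. Stating the equation with \<open>has_integral\<close> also demands that the
  integral exists, so a non-integrable integrand never counts as a solution. As \<open>P n r \<kappa>\<close> is a
  polynomial function on the whole real line, its one-sided derivatives at \<open>0\<close> and \<open>1\<close> agree with
  \<open>deriv\<close>.\<close>

definition p :: "nat \<Rightarrow> nat \<Rightarrow> real \<Rightarrow> real" where
  "p n r \<kappa> =
    (if \<kappa> = 1 then 1
     else (THE q. q \<in> {0<..<1} \<and>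
             ((\<lambda>z. z powr (- q) * deriv (P n r \<kappa>) z) has_integral 0) {0..1}))"

end

theory Submission
  imports Defs
begin

text \<open>
  For \<open>r = n - 1\<close> the second factor of \<open>P n r \<kappa>\<close> is linear, so with \<open>r = m + 1\<close> its derivative is
  \<open>r (1 - z)\<^sup>m\<close> times the linear function \<open>(\<kappa> - 1) - \<kappa> (r + 1) z\<close>. Against \<open>z powr (- q)\<close> the two
  terms integrate to the Beta values \<open>B(1 - q, r)\<close> and \<open>B(2 - q, r)\<close>, and the recurrence
  \<open>B(a + 1, b) = a / (a + b) B(a, b)\<close> turns the whole integral into \<open>B(1 - q, r)\<close> times a rational
  function of \<open>q\<close>. Since the Beta value is positive, the integral vanishes exactly when the numerator
  of that function does. This numerator is an affine function of \<open>q\<close>, with the claimed value as its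
  only root, and the root lies in \<open>(0, 1)\<close> when \<open>\<kappa> > 1\<close>. For \<open>\<kappa> = 1\<close> the formula reduces to \<open>1\<close>, the value
  fixed by definition.
\<close>

lemma deriv_P_linear_factor:
  "deriv (P (m + 2) (m + 1) \<kappa>) z =
     real (m + 1) * (1 - z) ^ m * ((\<kappa> - 1) - \<kappa> * real (m + 2) * z)"
proof -
  have "P (m + 2) (m + 1) \<kappa> = (\<lambda>z. (1 - z) ^ Suc m * (1 + \<kappa> * real (m + 1) * z))"
    by (auto simp: P_def fun_eq_iff)
  moreover have "((\<lambda>z. (1 - z) ^ Suc m * (1 + \<kappa> * real (m + 1) * z)) has_field_derivative
     real (m + 1) * (1 - z) ^ m * ((\<kappa> - 1) - \<kappa> * real (m + 2) * z)) (at z)"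
    by (rule derivative_eq_intros refl | simp)+ (simp add: algebra_simps)
  ultimately show ?thesis
    by (metis DERIV_imp_deriv)
qed

text \<open>The Beta integral with a natural power: \<open>0 powr 0 = 0\<close> while \<open>0 ^ 0 = 1\<close>, so for \<open>m = 0\<close> the
  integrand differs from the usual one at the end point \<open>1\<close>.\<close>

lemma has_integral_Beta_nat_power:
  fixes a :: real
  assumes "a > 0"
  shows "((\<lambda>t. t powr (a - 1) * (1 - t) ^ m) has_integral Beta a (real (m + 1))) {0..1}"
proof -
  have "((\<lambda>t. t powr (a - 1) * (1 - t) powr (real (m + 1) - 1))
          has_integral Beta a (real (m + 1))) {0..1}"
    using assms by (intro has_integral_Beta_real) auto
  then show ?thesis
    by (rule has_integral_spike_finite[where S = "{1}", rotated 2])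
       (auto simp: powr_realpow)
qed

lemma Beta_real_pos:
  fixes a b :: real
  assumes "a > 0" "b > 0"
  shows "Beta a b > 0"
  using assms by (simp add: Beta_def Gamma_real_pos)

lemma Beta_real_plus1_left:
  fixes a b :: real
  assumes "a > 0" "b > 0"
  shows "Beta (a + 1) b = a / (a + b) * Beta a b"
proof -
  have "a \<notin> \<int>\<^sub>\<le>\<^sub>0"
    using assms by (auto elim!: nonpos_Ints_cases)
  from Beta_plus1_left[OF this, of b] show ?thesis
    using assms by (simp add: field_simps)
qed

text \<open>Expanding the linear factor of the derivative gives two Beta integrals, and the Beta
  recurrence merges them. The result is factored so that, for \<open>0 < q < 1\<close>, only the last factor can
  vanish.\<close>

lemma has_integral_powr_deriv_P:
  fixes m :: nat and q \<kappa> :: real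
  assumes "q < 1"
  defines "b \<equiv> real (m + 1)"
  shows "((\<lambda>z. z powr (- q) * deriv (P (m + 2) (m + 1) \<kappa>) z) has_integral
           b / (1 - q + b) * Beta (1 - q) b * (q * (\<kappa> * b + 1) - (b + 1))) {0..1}"
proof -
  define a where "a = 1 - q"
  have a: "a > 0" and b: "b > 0"
    using assms by (auto simp: a_def)
  have "((\<lambda>t. b * (\<kappa> - 1) * (t powr (a - 1) * (1 - t) ^ m)
            - b * \<kappa> * (b + 1) * (t powr ((a + 1) - 1) * (1 - t) ^ m)) has_integral
          b * (\<kappa> - 1) * Beta a b - b * \<kappa> * (b + 1) * Beta (a + 1) b) {0..1}"
    unfolding b_def using a
    by (intro has_integral_diff has_integral_mult_right has_integral_Beta_nat_power) auto
  also have "b * (\<kappa> - 1) * Beta a b - b * \<kappa> * (b + 1) * Beta (a + 1) b =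
      b / (1 - q + b) * Beta (1 - q) b * (q * (\<kappa> * b + 1) - (b + 1))"
    using a b unfolding Beta_real_plus1_left[OF a b]
    by (simp add: a_def divide_simps) (simp add: algebra_simps)
  finally show ?thesis
  proof (rule has_integral_eq[rotated])
    fix t :: real
    assume "t \<in> {0..1}"
    \<comment> \<open>At \<open>t = 0\<close> the powers take the conventional value \<open>0\<close>, so the splitting also holds there.\<close>
    then have "t powr a = t powr (a - 1) * t"
      by (cases "t = 0") (auto simp: powr_diff)
    then show "b * (\<kappa> - 1) * (t powr (a - 1) * (1 - t) ^ m)
            - b * \<kappa> * (b + 1) * (t powr ((a + 1) - 1) * (1 - t) ^ m)
          = t powr (- q) * deriv (P (m + 2) (m + 1) \<kappa>) t"
      unfolding deriv_P_linear_factor by (simp add: a_def b_def algebra_simps)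
  qed
qed

theorem proposition6p1:
  fixes n :: nat and \<kappa> :: real
  assumes "n \<ge> 2" and "\<kappa> \<ge> 1"
  shows "p n (n - 1) \<kappa> = real n / ((real n - 1) * \<kappa> + 1)"
proof (cases "\<kappa> = 1")
  case True
  then show ?thesis
    using assms by (simp add: p_def)
next
  case False
  obtain m where n: "n = m + 2"
    using assms by (metis add.commute le_Suc_ex)
  define b where "b = real (m + 1)"
  define q0 where "q0 = (b + 1) / (\<kappa> * b + 1)"
  have \<kappa>: "\<kappa> > 1" and b: "b > 0"
    using False assms by (auto simp: b_def)
  have D: "\<kappa> * b > b"
    using \<kappa> b by simp
  have q0: "q0 \<in> {0<..<1}"
  proof -
    have "\<kappa> * b + 1 > b + 1" "b + 1 > 0"
      using D b by linarith+
    then show ?thesis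
      unfolding q0_def by simp
  qed
  have root: "((\<lambda>z. z powr (- q) * deriv (P n (n - 1) \<kappa>) z) has_integral 0) {0..1} \<longleftrightarrow> q = q0"
    if "q \<in> {0<..<1}" for q
  proof -
    let ?I = "b / (1 - q + b) * Beta (1 - q) b * (q * (\<kappa> * b + 1) - (b + 1))"
    have I: "((\<lambda>z. z powr (- q) * deriv (P n (n - 1) \<kappa>) z) has_integral ?I) {0..1}"
      using has_integral_powr_deriv_P[of q m \<kappa>] that by (simp add: n b_def)
    have "Beta (1 - q) b > 0"
      using that b by (intro Beta_real_pos) auto
    then have "?I = 0 \<longleftrightarrow> q * (\<kappa> * b + 1) = b + 1"
      using that b by simp
    also have "\<dots> \<longleftrightarrow> q = q0"
    proof -
      have "\<kappa> * b + 1 \<noteq> 0"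
        using b D by linarith
      then show ?thesis
        unfolding q0_def by (simp add: eq_divide_eq)
    qed
    finally have "?I = 0 \<longleftrightarrow> q = q0" .
    moreover have "((\<lambda>z. z powr (- q) * deriv (P n (n - 1) \<kappa>) z) has_integral 0) {0..1} \<longleftrightarrow> ?I = 0"
    proof
      assume "((\<lambda>z. z powr (- q) * deriv (P n (n - 1) \<kappa>) z) has_integral 0) {0..1}"
      with I show "?I = 0"
        by (rule has_integral_unique)
    next
      assume "?I = 0"
      with I show "((\<lambda>z. z powr (- q) * deriv (P n (n - 1) \<kappa>) z) has_integral 0) {0..1}"
        by (simp only:)
    qed
    ultimately show ?thesis
      by (simp only:)
  qed
  have "(THE q. q \<in> {0<..<1} \<and>
           ((\<lambda>z. z powr (- q) * deriv (P n (n - 1) \<kappa>) z) has_integral 0) {0..1}) = q0"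
    using q0 root by (intro the_equality) blast+
  then have "p n (n - 1) \<kappa> = q0"
    unfolding p_def using False by (simp only: if_False)
  then show ?thesis
    by (simp add: q0_def b_def n mult.commute)
qed

end
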